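(* The smallest order of a ring that is symmetric and not duo is $32$, and the ring $$\frac{\mathbb{F}_2\langle u,v\rangle}{\langle u^3,\,v^2,\,u^2+uv+vu,\,uvu\rangle}$$ is a symmetric nonduo ring of order $32$.
   Context: All rings are associative with unity. A ring $R$ is symmetric if for all $a,b,c\in R$, $abc=0$ implies $bac=0$; right duo if $ba\in aR$ for all $a,b\in R$, left duo if $ba\in Rb$ for all $a,b\in R$, and duo if it is both right and left duo. $\mathbb{F}_2\langle u,v\rangle$ is the free (noncommutative) associative unital $\mathbb{F}_2$-algebra on $u,v$, and $\langle\cdots\rangle$ in the denominator denotes the two-sided ideal generated by the listed elements. *)

theory Defs
  imports
    "HOL-Library.Z2"
    "HOL-Library.Poly_Mapping"
    "HOL-Algebra.QuotRing"
    "HOL-Algebra.Algebraic_Closure_Type"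
begin

locale symmetric_ring = ring R for R (structure) +
  assumes symmetric:
    "\<lbrakk>a \<in> carrier R; b \<in> carrier R; c \<in> carrier R; a \<otimes> b \<otimes> c = \<zero>\<rbrakk>
      \<Longrightarrow> b \<otimes> a \<otimes> c = \<zero>"

locale right_duo_ring = ring R for R (structure) +
  assumes right_duo:
    "\<lbrakk>a \<in> carrier R; b \<in> carrier R\<rbrakk> \<Longrightarrow> b \<otimes> a \<in> a <# carrier R"

locale left_duo_ring = ring R for R (structure) +
  assumes left_duo:
    "\<lbrakk>a \<in> carrier R; b \<in> carrier R\<rbrakk> \<Longrightarrow> b \<otimes> a \<in> carrier R #> b"

locale duo_ring = right_duo_ring R + left_duo_ring R for R (structure)

text \<open>
  Lists under concatenation are the free monoid, written additively because the
  product of \<^typ>\<open>'m \<Rightarrow>\<^sub>0 'k\<close> is convolution with respect to addition on \<^typ>\<open>'m\<close>.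
  Hence \<^typ>\<open>'x list \<Rightarrow>\<^sub>0 'k\<close> is the monoid algebra of the free monoid on \<^typ>\<open>'x\<close>,
  i.e. the free associative unital \<^typ>\<open>'k\<close>-algebra on \<^typ>\<open>'x\<close>.
\<close>

instantiation list :: (type) monoid_add
begin

definition zero_list :: "'a list" where
  "0 = []"

definition plus_list :: "'a list \<Rightarrow> 'a list \<Rightarrow> 'a list" where
  "xs + ys = xs @ ys"

instance
  by standard (simp_all add: zero_list_def plus_list_def)

end

type_synonym ('k, 'x) free_algebra = "'x list \<Rightarrow>\<^sub>0 'k"

definition free_gen :: "'x \<Rightarrow> ('k::ring_1, 'x) free_algebra" where
  "free_gen x = Poly_Mapping.single [x] 1"

datatype gen = U | V

abbreviation F2uv :: "(bit, gen) free_algebra ring" where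
  "F2uv \<equiv> ring_of_type_algebra"

lemma ring_F2uv: "ring F2uv"
proof -
  have "\<exists>y. x + y = 0" for x :: "(bit, gen) free_algebra"
    using add.right_inverse by blast
  then show ?thesis
    unfolding ring_of_type_algebra_def using add.right_inverse
    by unfold_locales (auto simp: algebra_simps Units_def)
qed

definition F2uv_quotient :: "(bit, gen) free_algebra set ring" where
  "F2uv_quotient =
    (let u = free_gen U; v = free_gen V
     in F2uv Quot (Idl\<^bsub>F2uv\<^esub> {u ^ 3, v ^ 2, u ^ 2 + u * v + v * u, u * v * u}))"

end

theory Submission
  imports Defs "HOL-Library.Product_Plus"
begin

text \<open>
  Let \<open>R\<close> be finite and symmetric. Idempotents are central, so splitting off the invertible part
  of \<open>a\<close> (and passing to the opposite ring if necessary) we may assume \<open>ba \<notin> aR\<close> with \<open>a\<close>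
  nilpotent. Put \<open>H = aR + baR\<close>. Then \<open>|aR| \<ge> 4\<close>, because \<open>0, a, ab, a + ab\<close> are distinct:
  reversibility turns \<open>a(b - k) = 0\<close> into \<open>ba = ak\<close>. Moreover \<open>H\<close> contains two cosets of \<open>aR\<close>, and
  \<open>1 \<notin> H\<close> by nilpotency. If \<open>H\<close> had fewer than four cosets then \<open>R\<close> would be the union of
  \<open>H\<close> and \<open>H \<plusminus> 1\<close>, which forces \<open>a\<close> to be central. Hence \<open>|R| \<ge> 4 \<cdot> 2 \<cdot> 4\<close>.
\<close>

section \<open>Counting cosets in abelian groups\<close>

text \<open>Elements of \<open>T\<close> represent different cosets of \<open>H\<close>, so
  \<open>(t, h) \<mapsto> h + t\<close> embeds \<open>T \<times> H\<close> into
  \<open>S\<close>.\<close>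

lemma (in abelian_group) card_transversal_le:
  assumes H: "additive_subgroup H G" and S: "additive_subgroup S G"
    and sub: "H \<subseteq> S" "T \<subseteq> S" and fin: "finite S"
    and T: "\<And>s t. \<lbrakk>s \<in> T; t \<in> T; s \<ominus> t \<in> H\<rbrakk> \<Longrightarrow> s = t"
  shows "card T * card H \<le> card S"
proof -
  interpret H: additive_subgroup H G by fact
  interpret S: additive_subgroup S G by fact
  have carr: "x \<in> carrier G" if "x \<in> S" for x
    using that S.a_subset by blast
  have "inj_on (\<lambda>(t, h). h \<oplus> t) (T \<times> H)"
  proof (intro inj_onI, clarsimp)
    fix s t g h
    assume st: "s \<in> T" "t \<in> T" and gh: "g \<in> H" "h \<in> H" and eq: "g \<oplus> s = h \<oplus> t"
    have c: "s \<in> carrier G" "t \<in> carrier G" "g \<in> carrier G" "h \<in> carrier G"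
      using st gh sub carr by auto
    have "s \<ominus> t = \<ominus> g \<oplus> (g \<oplus> s) \<ominus> t"
      using c by (simp add: r_neg1)
    also have "\<dots> = \<ominus> g \<oplus> h"
      using c by (simp add: eq a_minus_def a_assoc r_neg)
    finally have "s \<ominus> t \<in> H"
      using gh by simp
    then have "s = t"
      by (rule T[OF st])
    then show "s = t \<and> g = h"
      using eq c by simp
  qed
  moreover have "(\<lambda>(t, h). h \<oplus> t) ` (T \<times> H) \<subseteq> S"
    using sub by auto
  ultimately have "card (T \<times> H) \<le> card S"
    using fin card_inj_on_le by blast
  then show ?thesis
    by (simp add: card_cartesian_product)
qed

text \<open>The representatives are 0, \<open>x\<close>, \<open>y\<close> and \<open>x + y\<close>:
  up to sign, their pairwise differences are exactly \<open>x\<close>, \<open>y\<close>,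
  \<open>x - y\<close> and \<open>x + y\<close>. It is also used in contrapositive form, to cover a
  ring by few cosets.\<close>

lemma (in abelian_group) four_cosets_le:
  assumes H: "additive_subgroup H G" and S: "additive_subgroup S G"
    and sub: "H \<subseteq> S" and fin: "finite S"
    and xy: "x \<in> S" "y \<in> S" "x \<notin> H" "y \<notin> H" "x \<ominus> y \<notin> H" "x \<oplus> y \<notin> H"
  shows "4 * card H \<le> card S"
proof -
  interpret H: additive_subgroup H G by fact
  interpret S: additive_subgroup S G by fact
  have c: "x \<in> carrier G" "y \<in> carrier G"
    using xy S.a_subset by auto
  have neg: "\<ominus> z \<in> H \<longleftrightarrow> z \<in> H" if "z \<in> carrier G" for z
    using that H.a_inv_closed[of z] H.a_inv_closed[of "\<ominus> z"] by auto
  have "x \<ominus> (x \<oplus> y) = \<ominus> y" "x \<oplus> y \<ominus> y = x"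
    using c by (simp_all add: a_minus_def minus_add r_neg2 a_assoc r_neg)
  moreover have "y \<ominus> x = \<ominus> (x \<ominus> y)"
    using c by (simp add: a_minus_def minus_add a_comm)
  moreover have "y \<ominus> (x \<oplus> y) = \<ominus> x" "x \<oplus> y \<ominus> x = y"
    unfolding a_comm[OF c] using c by (simp_all add: a_minus_def minus_add r_neg2 a_assoc r_neg)
  ultimately have eqs: "x \<ominus> (x \<oplus> y) = \<ominus> y" "x \<oplus> y \<ominus> y = x" "y \<ominus> x = \<ominus> (x \<ominus> y)"
      "y \<ominus> (x \<oplus> y) = \<ominus> x" "x \<oplus> y \<ominus> x = y" .
  have sims: "\<zero> \<ominus> z = \<ominus> z" "z \<ominus> \<zero> = z" if "z \<in> carrier G" for z
    using that by (auto simp: a_minus_def)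
  have "\<zero> \<noteq> x" "\<zero> \<noteq> y" "x \<noteq> y" "x \<oplus> y \<noteq> \<zero>" "x \<oplus> y \<noteq> x" "x \<oplus> y \<noteq> y"
    using xy c H.zero_closed by (auto simp: a_minus_def r_neg)
  then have "card {\<zero>, x, y, x \<oplus> y} = 4"
    by auto
  moreover have "card {\<zero>, x, y, x \<oplus> y} * card H \<le> card S"
  proof (rule card_transversal_le[OF H S sub _ fin])
    show "{\<zero>, x, y, x \<oplus> y} \<subseteq> S"
      using xy by simp
    show "s = t" if "s \<in> {\<zero>, x, y, x \<oplus> y}" "t \<in> {\<zero>, x, y, x \<oplus> y}" "s \<ominus> t \<in> H" for s t
      using that xy c by (auto simp: sims eqs neg)
  qed
  ultimately show ?thesis
    by simp
qed

section \<open>Zero products, idempotents and commutators in symmetric rings\<close>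

context symmetric_ring
begin

lemma mult_eq_zero_commute:
  assumes "a \<in> carrier R" "b \<in> carrier R" "a \<otimes> b = \<zero>"
  shows "b \<otimes> a = \<zero>"
  using symmetric[of a b \<one>] assms by simp

text \<open>From \<open>ba = 0\<close> follows \<open>b(ar) = 0\<close>, and commuting this zero
  product gives \<open>(ar)b = 0\<close>.\<close>

lemma mult_eq_zero_insert:
  assumes "a \<in> carrier R" "b \<in> carrier R" "r \<in> carrier R" "a \<otimes> b = \<zero>"
  shows "a \<otimes> r \<otimes> b = \<zero>"
proof -
  have "b \<otimes> (a \<otimes> r) = b \<otimes> a \<otimes> r"
    using assms by (simp add: m_assoc)
  also have "\<dots> = \<zero>"
    using mult_eq_zero_commute assms by simp
  finally show ?thesis
    using mult_eq_zero_commute assms by simp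
qed

text \<open>Inserting \<open>r\<close> into \<open>e(1 - e) = 0\<close> and
  \<open>(1 - e)e = 0\<close> yields \<open>er = ere = re\<close>.\<close>

lemma idempotent_central:
  assumes e: "e \<in> carrier R" "e \<otimes> e = e" and r: "r \<in> carrier R"
  shows "e \<otimes> r = r \<otimes> e"
proof -
  have c: "\<one> \<ominus> e \<in> carrier R"
    using e by simp
  have "e \<otimes> (\<one> \<ominus> e) = \<zero>" "(\<one> \<ominus> e) \<otimes> e = \<zero>"
    using e by (simp_all add: a_minus_def l_distr r_distr l_minus r_minus r_neg)
  then have "e \<otimes> r \<otimes> (\<one> \<ominus> e) = \<zero>" "(\<one> \<ominus> e) \<otimes> r \<otimes> e = \<zero>"
    using mult_eq_zero_insert e r c by auto
  then have "e \<otimes> r \<ominus> e \<otimes> r \<otimes> e = \<zero>" "r \<otimes> e \<ominus> e \<otimes> r \<otimes> e = \<zero>"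
    using e r by (simp_all add: a_minus_def l_distr r_distr l_minus r_minus m_assoc)
  then show ?thesis
    using e r by (metis m_closed r_right_minus_eq)
qed

text \<open>If \<open>R\<close> is covered by \<open>H\<close>, \<open>H + 1\<close> and \<open>H - 1\<close> with \<open>H = aR + baR\<close>, then one factor \<open>a\<close>
  after another can be cancelled from \<open>[x, a] a\<^sup>n = 0\<close>, since \<open>[ay + baz, a]\<close> equals
  \<open>a[y, a] + ba[z, a] + [b, a]az\<close>.\<close>

lemma nilpotent_commutes:
  assumes ab: "a \<in> carrier R" "b \<in> carrier R" and nil: "a [^] (n::nat) = \<zero>"
    and cover: "\<And>x. x \<in> carrier R \<Longrightarrow> \<exists>y\<in>carrier R. \<exists>z\<in>carrier R. \<exists>c\<in>{\<zero>, \<one>, \<ominus> \<one>}.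
      x = a \<otimes> y \<oplus> b \<otimes> a \<otimes> z \<oplus> c"
    and x: "x \<in> carrier R"
  shows "x \<otimes> a = a \<otimes> x"
proof -
  define D where "D x = x \<otimes> a \<ominus> a \<otimes> x" for x
  have D: "D x \<in> carrier R" if "x \<in> carrier R" for x
    using that ab by (simp add: D_def)
  \<comment> \<open>Downward induction from \<open>k = n\<close>, where the power vanishes, to
    \<open>k = 0\<close>, where the claim is that \<open>x\<close> commutes with
    \<open>a\<close>.\<close>
  have *: "\<forall>x\<in>carrier R. D x \<otimes> a [^] k = \<zero>" if "k \<le> n" for k
    using that
  proof (induction rule: inc_induct)
    case base
    then show ?case using nil D by simp
  next
    case (step k)
    have p: "a [^] k \<in> carrier R"
      using ab by simp
    have IH: "D t \<otimes> a \<otimes> a [^] k = \<zero>" if "t \<in> carrier R" for t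
    proof -
      have "D t \<otimes> a \<otimes> a [^] k = D t \<otimes> a [^] Suc k"
        using D that ab by (metis m_assoc nat_pow_Suc2 p)
      then show ?thesis using step.IH that by simp
    qed
    show ?case
    proof
      fix x assume "x \<in> carrier R"
      then obtain y z c where yz: "y \<in> carrier R" "z \<in> carrier R" and c: "c \<in> {\<zero>, \<one>, \<ominus> \<one>}"
        and x: "x = a \<otimes> y \<oplus> b \<otimes> a \<otimes> z \<oplus> c"
        using cover by blast
      have cc: "c \<in> carrier R" and ca: "c \<otimes> a = a \<otimes> c"
        using c ab by (auto simp: l_minus r_minus)
      have "D x = a \<otimes> D y \<oplus> b \<otimes> (a \<otimes> D z) \<oplus> D b \<otimes> a \<otimes> z \<oplus> (c \<otimes> a \<ominus> a \<otimes> c)"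
        unfolding D_def x using ab yz cc by algebra
      also have "\<dots> = a \<otimes> D y \<oplus> b \<otimes> (a \<otimes> D z) \<oplus> D b \<otimes> a \<otimes> z"
        using ab yz cc D by (simp add: ca a_minus_def r_neg)
      finally have "D x \<otimes> a [^] k = a \<otimes> D y \<otimes> a [^] k \<oplus> b \<otimes> (a \<otimes> D z \<otimes> a [^] k)
          \<oplus> D b \<otimes> a \<otimes> z \<otimes> a [^] k"
        using ab yz D p by (simp add: l_distr m_assoc)
      \<comment> \<open>The induction hypothesis reads \<open>D t \<cdot> a \<cdot> a^k = 0\<close>.
        Symmetry exchanges its first two factors, which removes the terms in \<open>D y\<close> and
        \<open>D z\<close>; for the term in \<open>D b\<close>, the factor \<open>z\<close> is
        inserted in front of \<open>a^k\<close>.\<close>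
      moreover have "a \<otimes> D t \<otimes> a [^] k = \<zero>" if "t \<in> carrier R" for t
        using symmetric[OF D[OF that] _ p IH[OF that]] ab by simp
      moreover have "D b \<otimes> a \<otimes> z \<otimes> a [^] k = \<zero>"
        using mult_eq_zero_insert[OF _ p yz(2) IH] ab D by simp
      ultimately show "D x \<otimes> a [^] k = \<zero>"
        using yz ab by simp
    qed
  qed
  have "D x = \<zero>"
    using *[of 0] x D by simp
  then show ?thesis
    using x ab by (simp add: D_def)
qed

section \<open>The bound for a nilpotent witness\<close>

lemma order_ge_32_nilpotent:
  assumes fin: "finite (carrier R)" and ab: "a \<in> carrier R" "b \<in> carrier R"
    and nil: "a [^] (n::nat) = \<zero>" and ba: "b \<otimes> a \<notin> a <# carrier R"
  shows "32 \<le> Coset.order R"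
proof -
  define A where "A = a <# carrier R"
  define H where "H = (\<lambda>(y, z). a \<otimes> y \<oplus> b \<otimes> a \<otimes> z) ` (carrier R \<times> carrier R)"
  have memA: "x \<in> A \<longleftrightarrow> (\<exists>y\<in>carrier R. x = a \<otimes> y)" for x
    by (auto simp: A_def l_coset_def)
  have memH: "x \<in> H \<longleftrightarrow> (\<exists>y\<in>carrier R. \<exists>z\<in>carrier R. x = a \<otimes> y \<oplus> b \<otimes> a \<otimes> z)" for x
    by (auto simp: H_def)
  have A_sub: "A \<subseteq> carrier R" and H_sub: "H \<subseteq> carrier R"
    using ab by (auto simp: memA memH)
  have AsubH: "A \<subseteq> H"
  proof
    fix x assume "x \<in> A"
    then obtain y where y: "y \<in> carrier R" "x = a \<otimes> y"
      using memA by blast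
    then have "x = a \<otimes> y \<oplus> b \<otimes> a \<otimes> \<zero>"
      using ab by simp
    then show "x \<in> H"
      using y memH zero_closed by blast
  qed
  have subR: "additive_subgroup (carrier R) R"
    by (simp add: additive_subgroup_def add.subgroup_self)
  have subA: "additive_subgroup A R"
    unfolding additive_subgroup_def
  proof (rule add.subgroupI)
    show "A \<noteq> {}" using memA by blast
    show "\<ominus> x \<in> A" if "x \<in> A" for x
      using that ab by (metis memA r_minus a_inv_closed)
    show "x \<oplus> y \<in> A" if "x \<in> A" "y \<in> A" for x y
      using that ab by (metis memA r_distr a_closed)
  qed (use A_sub in auto)
  have subH: "additive_subgroup H R"
    unfolding additive_subgroup_def
  proof (rule add.subgroupI)
    show "H \<noteq> {}" using memH by blast
    show "\<ominus> x \<in> H" if x: "x \<in> H" for x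
    proof -
      obtain y z where yz: "y \<in> carrier R" "z \<in> carrier R" "x = a \<otimes> y \<oplus> b \<otimes> a \<otimes> z"
        using x memH by blast
      have "\<ominus> x = a \<otimes> (\<ominus> y) \<oplus> b \<otimes> a \<otimes> (\<ominus> z)"
        using yz ab by (simp add: r_minus minus_add)
      then show ?thesis using yz memH a_inv_closed by blast
    qed
    show "x \<oplus> x' \<in> H" if x: "x \<in> H" "x' \<in> H" for x x'
    proof -
      obtain y z where yz: "y \<in> carrier R" "z \<in> carrier R" "x = a \<otimes> y \<oplus> b \<otimes> a \<otimes> z"
        using x memH by blast
      obtain y' z' where yz': "y' \<in> carrier R" "z' \<in> carrier R" "x' = a \<otimes> y' \<oplus> b \<otimes> a \<otimes> z'"
        using x memH by blast
      have "x \<oplus> x' = a \<otimes> (y \<oplus> y') \<oplus> b \<otimes> a \<otimes> (z \<oplus> z')"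
        using yz yz' ab by (simp add: r_distr a_ac)
      then show ?thesis using yz yz' memH a_closed by blast
    qed
  qed (use H_sub in auto)
  have finA: "finite A" and finH: "finite H"
    using fin A_sub H_sub finite_subset by auto
  have baA: "b \<otimes> a \<notin> A"
    using ba by (simp add: A_def)
  \<comment> \<open>These three values of \<open>c\<close> are central, so
    \<open>(b - c)a = 0\<close> would put \<open>ba = ac\<close> into \<open>A\<close>. They cover
    the cases \<open>ab = 0\<close>, \<open>ab = a\<close> and \<open>ab = -a\<close>.\<close>
  have scalar: False if c: "c \<in> {\<zero>, \<one>, \<ominus> \<one>}" and eq: "a \<otimes> b = a \<otimes> c" for c
  proof -
    have cc: "c \<in> carrier R" and ca: "c \<otimes> a = a \<otimes> c"
      using c ab by (auto simp: l_minus r_minus)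
    have "a \<otimes> (b \<ominus> c) = \<zero>"
      using ab cc eq by (simp add: a_minus_def r_distr r_minus r_neg)
    then have "(b \<ominus> c) \<otimes> a = \<zero>"
      using mult_eq_zero_commute ab cc by simp
    moreover have "b \<otimes> a = (b \<ominus> c) \<otimes> a \<oplus> c \<otimes> a"
      using ab cc by algebra
    ultimately have "b \<otimes> a = a \<otimes> c"
      using ab cc ca by simp
    then show False
      using baA cc memA by blast
  qed
  have "4 * card {\<zero>} \<le> card A"
  proof (rule four_cosets_le[OF _ subA _ finA])
    show "additive_subgroup {\<zero>} R"
      by (simp add: additive_subgroup_def add.triv_subgroup)
    show "{\<zero>} \<subseteq> A"
      using subA by (simp add: additive_subgroup.zero_closed)
    show "a \<in> A" "a \<otimes> b \<in> A"
      using ab memA by (metis one_closed r_one, blast)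
    show "a \<notin> {\<zero>}"
      using baA ab subA by (auto simp: additive_subgroup.zero_closed)
    show "a \<otimes> b \<notin> {\<zero>}"
      using scalar[of \<zero>] ab by auto
    show "a \<ominus> a \<otimes> b \<notin> {\<zero>}"
      using scalar[of \<one>] ab by auto
    show "a \<oplus> a \<otimes> b \<notin> {\<zero>}"
    proof
      assume "a \<oplus> a \<otimes> b \<in> {\<zero>}"
      then have "a \<otimes> b = \<ominus> a"
        using ab by (metis minus_equality a_comm m_closed singletonD)
      then show False
        using scalar[of "\<ominus> \<one>"] ab by (simp add: r_minus)
    qed
  qed
  moreover have "2 * card A \<le> card H"
  proof -
    have "b \<otimes> a = a \<otimes> \<zero> \<oplus> b \<otimes> a \<otimes> \<one>"
      using ab by simp
    then have baH: "b \<otimes> a \<in> H"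
      using memH zero_closed one_closed by blast
    have "card {\<zero>, b \<otimes> a} * card A \<le> card H"
    proof (rule card_transversal_le[OF subA subH AsubH _ finH])
      show "{\<zero>, b \<otimes> a} \<subseteq> H"
        using baH subH by (simp add: additive_subgroup.zero_closed)
      have "\<ominus> (b \<otimes> a) \<notin> A"
        using baA ab additive_subgroup.a_inv_closed[OF subA] by force
      then show "s = t" if "s \<in> {\<zero>, b \<otimes> a}" "t \<in> {\<zero>, b \<otimes> a}" "s \<ominus> t \<in> A" for s t
        using that baA ab by (auto simp: a_minus_def)
    qed
    moreover have "b \<otimes> a \<noteq> \<zero>"
      using baA additive_subgroup.zero_closed[OF subA] by auto
    ultimately show ?thesis
      by simp
  qed
  moreover have "4 * card H \<le> card (carrier R)"
  proof (rule ccontr)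
    assume small: "\<not> 4 * card H \<le> card (carrier R)"
    have one: "\<one> \<notin> H"
    proof
      assume "\<one> \<in> H"
      then obtain y z where yz: "y \<in> carrier R" "z \<in> carrier R"
        and eq: "\<one> = a \<otimes> y \<oplus> b \<otimes> a \<otimes> z"
        using memH by blast
      have p: "a [^] k \<in> carrier R" for k :: nat
        using ab by simp
      \<comment> \<open>Multiply the equation for 1 by \<open>a^k\<close> on the left: the first
        summand contains \<open>a^k a = 0\<close>, the second vanishes after inserting
        \<open>b\<close>. Descending to exponent 0 gives \<open>1 = 0\<close>.\<close>
      have down: "a [^] k = \<zero>" if "a [^] Suc k = \<zero>" for k :: nat
      proof -
        have k: "a [^] k \<otimes> a = \<zero>"
          using that by simp
        have "a [^] k = a [^] k \<otimes> (a \<otimes> y \<oplus> b \<otimes> a \<otimes> z)"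
          using p by (simp flip: eq)
        also have "\<dots> = a [^] k \<otimes> a \<otimes> y \<oplus> a [^] k \<otimes> b \<otimes> a \<otimes> z"
          using ab yz p by (simp add: r_distr m_assoc)
        also have "\<dots> = \<zero>"
          using mult_eq_zero_insert[OF p _ _ k] ab yz k by simp
        finally show ?thesis .
      qed
      have "a [^] (0::nat) = \<zero>"
        by (rule inc_induct[of 0 n "\<lambda>k. a [^] k = \<zero>"]) (use nil down in auto)
      then have "\<one> = \<zero>" by simp
      then have "b \<otimes> a = \<zero>"
        using ab by (metis l_one l_null m_closed)
      then show False
        using baA additive_subgroup.zero_closed[OF subA] by simp
    qed
    have "\<exists>y\<in>carrier R. \<exists>z\<in>carrier R. \<exists>c\<in>{\<zero>, \<one>, \<ominus> \<one>}. x = a \<otimes> y \<oplus> b \<otimes> a \<otimes> z \<oplus> c"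
      if x: "x \<in> carrier R" for x
    proof -
      \<comment> \<open>Contrapositive of \<open>four_cosets_le\<close> with second representative
        1: as \<open>1 \<notin> H\<close> and there is no room for four cosets, \<open>x\<close>
        must lie in \<open>H\<close>, \<open>H + 1\<close> or \<open>H - 1\<close>.\<close>
      have "x \<in> H \<or> x \<ominus> \<one> \<in> H \<or> x \<oplus> \<one> \<in> H"
        using four_cosets_le[OF subH subR H_sub fin x one_closed] one small by blast
      moreover have "x = x \<oplus> \<zero>" "x = (x \<ominus> \<one>) \<oplus> \<one>" "x = (x \<oplus> \<one>) \<oplus> \<ominus> \<one>"
        using x by (simp_all add: a_minus_def a_assoc l_neg r_neg)
      ultimately obtain h c where "h \<in> H" and c: "c \<in> {\<zero>, \<one>, \<ominus> \<one>}" and x: "x = h \<oplus> c"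
        by blast
      then obtain y z where "y \<in> carrier R" "z \<in> carrier R" "h = a \<otimes> y \<oplus> b \<otimes> a \<otimes> z"
        using memH by blast
      then show ?thesis
        using c x by (intro bexI[of _ y] bexI[of _ z] bexI[of _ c]) simp_all
    qed
    from nilpotent_commutes[OF ab nil this ab(2)] have "b \<otimes> a = a \<otimes> b"
      by simp
    then show False
      using baA ab memA by metis
  qed
  ultimately show ?thesis
    by (simp add: Coset.order_def)
qed

section \<open>Reduction to the nilpotent case\<close>

lemma exists_idempotent_power:
  assumes fin: "finite (carrier R)" and a: "a \<in> carrier R"
  obtains m :: nat where "0 < m" "a [^] m \<otimes> a [^] m = a [^] m"
proof -
  have "\<not> inj_on (\<lambda>i::nat. a [^] i) UNIV"
  proof
    assume "inj (\<lambda>i::nat. a [^] i)"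
    moreover have "range (\<lambda>i::nat. a [^] i) \<subseteq> carrier R"
      using a by auto
    then have "finite (range (\<lambda>i::nat. a [^] i))"
      using fin by (rule finite_subset)
    ultimately show False
      using finite_imageD infinite_UNIV_nat by blast
  qed
  then obtain i j :: nat where ij: "i < j" "a [^] i = a [^] j"
    unfolding inj_def by (metis linorder_neqE_nat)
  define k where "k = j - i"
  have k: "0 < k" "a [^] (i + k) = a [^] i"
    using ij by (auto simp: k_def)
  have shift: "a [^] (l + k) = a [^] l" if "i \<le> l" for l
  proof -
    have "a [^] (l + k) = a [^] (l - i) \<otimes> a [^] (i + k)"
      using that a by (simp add: nat_pow_mult add.assoc)
    also have "\<dots> = a [^] l"
      using that a k by (simp add: nat_pow_mult)
    finally show ?thesis .
  qed
  have "a [^] (l + t * k) = a [^] l" if "i \<le> l" for l t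
  proof (induction t)
    case (Suc t)
    then show ?case
      using shift[of "l + t * k"] that by (simp add: ac_simps)
  qed simp
  \<comment> \<open>The exponent \<open>Suc i * k\<close> is a multiple of the period
    \<open>k\<close> and at least the preperiod \<open>i\<close>; \<open>Suc i\<close> instead of
    \<open>i\<close> keeps it positive.\<close>
  from this[of "Suc i * k" "Suc i"] have "a [^] (Suc i * k + Suc i * k) = a [^] (Suc i * k)"
    using k(1) by (cases k) simp_all
  then have "a [^] (Suc i * k) \<otimes> a [^] (Suc i * k) = a [^] (Suc i * k)"
    using a by (simp only: nat_pow_mult)
  then show thesis
    using that k(1) by (metis mult_pos_pos zero_less_Suc)
qed

text \<open>A central idempotent \<open>a\<^sup>m\<close> splits \<open>a\<close> into a unit part and a nilpotent part, and only
  the nilpotent part can violate the duo condition.\<close>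

lemma order_ge_32_right:
  assumes fin: "finite (carrier R)" and nd: "\<not> right_duo_ring R"
  shows "32 \<le> Coset.order R"
proof -
  obtain a b where ab: "a \<in> carrier R" "b \<in> carrier R" and ba: "b \<otimes> a \<notin> a <# carrier R"
    using nd ring_axioms by (auto simp: right_duo_ring_def right_duo_ring_axioms_def)
  obtain m :: nat where m: "0 < m" "a [^] m \<otimes> a [^] m = a [^] m"
    using exists_idempotent_power[OF fin ab(1)] .
  define e where "e = a [^] m"
  have e: "e \<in> carrier R" "e \<otimes> e = e"
    using m ab by (auto simp: e_def)
  define f where "f = \<one> \<ominus> e"
  have f: "f \<in> carrier R"
    using e by (simp add: f_def)
  have ff: "f \<otimes> f = f" and fe: "f \<otimes> e = \<zero>"
    using e by (simp_all add: f_def a_minus_def l_distr r_distr l_minus r_minus r_neg minus_add a_ac)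
  note central = idempotent_central[OF f ff]
  \<comment> \<open>Only positive exponents are claimed: the power 0 is 1 on the left, but would be
    \<open>f\<close> on the right.\<close>
  have pow: "(f \<otimes> a) [^] Suc k = f \<otimes> a [^] Suc k" for k
  proof (induction k)
    case 0
    then show ?case using ab f by simp
  next
    case (Suc k)
    have p: "a [^] Suc k \<in> carrier R"
      using ab by simp
    have "(f \<otimes> a) [^] Suc (Suc k) = f \<otimes> a [^] Suc k \<otimes> (f \<otimes> a)"
      using Suc.IH by (subst nat_pow_Suc) simp
    also have "\<dots> = f \<otimes> (a [^] Suc k \<otimes> f) \<otimes> a"
      using ab f p by (simp add: m_assoc)
    also have "\<dots> = f \<otimes> (f \<otimes> a [^] Suc k) \<otimes> a"
      using central[OF p] by simp
    also have "\<dots> = f \<otimes> f \<otimes> (a [^] Suc k \<otimes> a)"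
      using ab f p by (simp add: m_assoc)
    finally show ?case
      using ff by simp
  qed
  have "(f \<otimes> a) [^] m = f \<otimes> e"
    using pow[of "m - 1"] m by (simp add: e_def)
  then have nil: "(f \<otimes> a) [^] m = \<zero>"
    using fe by simp
  have "b \<otimes> (f \<otimes> a) \<notin> (f \<otimes> a) <# carrier R"
  proof
    assume "b \<otimes> (f \<otimes> a) \<in> (f \<otimes> a) <# carrier R"
    then obtain r where r: "r \<in> carrier R" "b \<otimes> (f \<otimes> a) = f \<otimes> a \<otimes> r"
      by (auto simp: l_coset_def)
    have "f \<otimes> a \<otimes> r = a \<otimes> (f \<otimes> r)"
      using central[OF ab(1)] ab f r by (simp add: m_assoc)
    \<comment> \<open>The component of \<open>ba\<close> along \<open>e\<close> always lies in
      \<open>aR\<close>, since \<open>e\<close> is central and, by \<open>m > 0\<close>, starts with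
      a factor \<open>a\<close>. Hence \<open>ba \<notin> aR\<close> must come from the component
      along \<open>f\<close>.\<close>
    moreover have "b \<otimes> (e \<otimes> a) = a \<otimes> (a [^] (m - 1) \<otimes> b \<otimes> a)"
    proof -
      have "e = a \<otimes> a [^] (m - 1)"
        using m ab by (metis Suc_pred' e_def nat_pow_Suc2)
      moreover have "b \<otimes> (e \<otimes> a) = e \<otimes> b \<otimes> a"
        using idempotent_central[OF e ab(2)] e ab by (simp add: m_assoc)
      ultimately show ?thesis
        using ab by (simp add: m_assoc)
    qed
    moreover have "b \<otimes> a = b \<otimes> (f \<otimes> a) \<oplus> b \<otimes> (e \<otimes> a)"
      unfolding f_def using ab e by algebra
    ultimately have "b \<otimes> a = a \<otimes> (f \<otimes> r \<oplus> a [^] (m - 1) \<otimes> b \<otimes> a)"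
      using r ab f by (simp add: r_distr)
    then show False
      using ba r ab f by (auto simp: l_coset_def)
  qed
  then show ?thesis
    using order_ge_32_nilpotent[OF fin _ _ nil] ab f by simp
qed

end

section \<open>Exchanging left and right\<close>

definition opposite_ring :: "('a, 'm) ring_scheme \<Rightarrow> ('a, 'm) ring_scheme" where
  "opposite_ring R = R\<lparr>mult := \<lambda>x y. y \<otimes>\<^bsub>R\<^esub> x\<rparr>"

lemma opposite_ring_simps [simp]:
  "carrier (opposite_ring R) = carrier R"
  "x \<otimes>\<^bsub>opposite_ring R\<^esub> y = y \<otimes>\<^bsub>R\<^esub> x"
  "\<one>\<^bsub>opposite_ring R\<^esub> = \<one>\<^bsub>R\<^esub>"
  "\<zero>\<^bsub>opposite_ring R\<^esub> = \<zero>\<^bsub>R\<^esub>"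
  "x \<oplus>\<^bsub>opposite_ring R\<^esub> y = x \<oplus>\<^bsub>R\<^esub> y"
  by (simp_all add: opposite_ring_def)

context symmetric_ring
begin

text \<open>Commuting zero products moves \<open>c\<close> from the left end to the right, where
  symmetry applies, and back again.\<close>

lemma symmetric_ring_opposite: "symmetric_ring (opposite_ring R)"
proof -
  have "ring (opposite_ring R)"
  proof (intro ringI abelian_groupI monoidI)
    show "\<exists>y\<in>carrier (opposite_ring R). y \<oplus>\<^bsub>opposite_ring R\<^esub> x = \<zero>\<^bsub>opposite_ring R\<^esub>"
      if "x \<in> carrier (opposite_ring R)" for x
      using that l_neg a_inv_closed by auto
  qed (simp_all add: m_assoc l_distr r_distr a_ac)
  moreover have "c \<otimes> (a \<otimes> b) = \<zero>"
    if "a \<in> carrier R" "b \<in> carrier R" "c \<in> carrier R" "c \<otimes> (b \<otimes> a) = \<zero>" for a b c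
    using that by (metis m_closed mult_eq_zero_commute symmetric)
  ultimately show ?thesis
    by (simp add: symmetric_ring_def symmetric_ring_axioms_def)
qed

lemma order_ge_32:
  assumes fin: "finite (carrier R)" and nd: "\<not> duo_ring R"
  shows "32 \<le> Coset.order R"
proof (cases "right_duo_ring R")
  case True
  then have "\<not> left_duo_ring R"
    using nd by (simp add: duo_ring_def)
  then have "\<not> right_duo_ring (opposite_ring R)"
    using ring_axioms by (auto simp: left_duo_ring_def left_duo_ring_axioms_def
        right_duo_ring_def right_duo_ring_axioms_def l_coset_def r_coset_def)
  then have "32 \<le> Coset.order (opposite_ring R)"
    using symmetric_ring.order_ge_32_right[OF symmetric_ring_opposite] fin by simp
  then show ?thesis
    by (simp add: Coset.order_def)
qed (rule order_ge_32_right[OF fin])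

end

section \<open>Coefficients of products in the free algebra\<close>

text \<open>The factorizations of \<open>w\<close> in the free monoid are its cuts into a prefix and
  a suffix, one for each \<open>i \<le> length w\<close>, so the convolution becomes a finite
  sum.\<close>

lemma lookup_mult_list:
  fixes p q :: "'x list \<Rightarrow>\<^sub>0 'k::semiring_0"
  shows "Poly_Mapping.lookup (p * q) w = (\<Sum>i\<le>length w. Poly_Mapping.lookup p (take i w) * Poly_Mapping.lookup q (drop i w))"
proof -
  let ?g = "\<lambda>(a, b). Poly_Mapping.lookup p a * Poly_Mapping.lookup q b when w = a + b"
  let ?s = "\<lambda>i. (take i w, drop i w)"
  have "Poly_Mapping.lookup (p * q) w = prod_fun (Poly_Mapping.lookup p) (Poly_Mapping.lookup q) w"
    by transfer simp
  also have "\<dots> = Sum_any ?g"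
    by (rule prod_fun_unfold_prod) simp_all
  also have "\<dots> = sum ?g (?s ` {..length w})"
  proof (rule Sum_any.expand_superset)
    show "{x. ?g x \<noteq> 0} \<subseteq> ?s ` {..length w}"
    proof clarify
      fix a b
      assume "(Poly_Mapping.lookup p a * Poly_Mapping.lookup q b when w = a + b) \<noteq> 0"
      then have "w = a @ b"
        by (auto simp: when_def plus_list_def split: if_splits)
      then have "(a, b) = ?s (length a)" "length a \<le> length w"
        by simp_all
      then show "(a, b) \<in> ?s ` {..length w}"
        by blast
    qed
  qed simp
  also have "\<dots> = (\<Sum>i\<le>length w. ?g (?s i))"
  proof (subst sum.reindex)
    show "inj_on ?s {..length w}"
      by (rule inj_onI) (metis Pair_inject atMost_iff length_take min.absorb2)
  qed simp
  finally show ?thesis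
    by (simp add: plus_list_def)
qed

declare add_bit_eq_xor [simp del] mult_bit_eq_and [simp del]

section \<open>A five-coordinate model of the quotient\<close>

type_synonym quint = "bit \<times> bit \<times> bit \<times> bit \<times> bit"

text \<open>Since \<open>u\<^sup>2 = uv + vu\<close> modulo the relations and all words of length three vanish,
  the quotient has basis \<open>1, u, v, uv, vu\<close>.\<close>

definition coords :: "(bit, gen) free_algebra \<Rightarrow> quint" where
  "coords p = (Poly_Mapping.lookup p [], Poly_Mapping.lookup p [U], Poly_Mapping.lookup p [V],
     Poly_Mapping.lookup p [U, V] + Poly_Mapping.lookup p [U, U], Poly_Mapping.lookup p [V, U] + Poly_Mapping.lookup p [U, U])"

fun rep :: "quint \<Rightarrow> (bit, gen) free_algebra" where
  "rep (k, l, m, n, r) = Poly_Mapping.single [] k + Poly_Mapping.single [U] l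
     + Poly_Mapping.single [V] m + Poly_Mapping.single [U, V] n + Poly_Mapping.single [V, U] r"

text \<open>Multiplication in the basis 1, \<open>u\<close>, \<open>v\<close>, \<open>uv\<close>,
  \<open>vu\<close>. The term \<open>l * l'\<close> occurs twice because
  \<open>u^2 = uv + vu\<close>, and \<open>m * m'\<close> is absent because
  \<open>v^2 = 0\<close>.\<close>

fun qmult :: "quint \<Rightarrow> quint \<Rightarrow> quint" where
  "qmult (k, l, m, n, r) (k', l', m', n', r') =
     (k * k', k * l' + l * k', k * m' + m * k',
      k * n' + n * k' + l * m' + l * l', k * r' + r * k' + m * l' + l * l')"

lemma coords_zero [simp]: "coords 0 = 0"
  by (simp add: coords_def zero_prod_def)

lemma coords_add [simp]: "coords (p + q) = coords p + coords q"
  by (simp add: coords_def lookup_add ac_simps)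

lemma coords_uminus [simp]: "coords (- p) = - coords p"
  by (simp add: coords_def)

lemma coords_diff [simp]: "coords (p - q) = coords p - coords q"
  using coords_add[of p "- q"] by simp

lemma lookup_mult_short:
  fixes p q :: "'x list \<Rightarrow>\<^sub>0 'k::semiring_0"
  shows "Poly_Mapping.lookup (p * q) [] = Poly_Mapping.lookup p [] * Poly_Mapping.lookup q []"
    and "Poly_Mapping.lookup (p * q) [x] = Poly_Mapping.lookup p [] * Poly_Mapping.lookup q [x]
      + Poly_Mapping.lookup p [x] * Poly_Mapping.lookup q []"
    and "Poly_Mapping.lookup (p * q) [x, y] = Poly_Mapping.lookup p [] * Poly_Mapping.lookup q [x, y]
      + Poly_Mapping.lookup p [x] * Poly_Mapping.lookup q [y]
      + Poly_Mapping.lookup p [x, y] * Poly_Mapping.lookup q []"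
  by (simp_all add: lookup_mult_list atMost_Suc add.assoc add.commute add.left_commute)

text \<open>Longer words do not interfere, because \<open>coords\<close> reads only coefficients of
  words of length at most two, and these depend only on such coefficients of the factors. With
  additivity, this makes the kernel of \<open>coords\<close> an ideal.\<close>

lemma coords_mult [simp]: "coords (p * q) = qmult (coords p) (coords q)"
  by (simp add: coords_def lookup_mult_short distrib_left distrib_right add.assoc add.commute add.left_commute)

lemma coords_rep [simp]: "coords (rep t) = t"
  by (cases t) (simp add: coords_def lookup_add lookup_single)

lemma rep_add: "rep (s + t) = rep s + rep t"
  by (cases s; cases t) (simp add: single_add algebra_simps)

lemma rep_zero [simp]: "rep 0 = 0"
  by (simp add: zero_prod_def)

section \<open>The relator ideal is the kernel of \<open>coords\<close>\<close>

definition relators :: "(bit, gen) free_algebra set" where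
  "relators = (let u = free_gen U; v = free_gen V
     in {u ^ 3, v ^ 2, u ^ 2 + u * v + v * u, u * v * u})"

definition relator_ideal :: "(bit, gen) free_algebra set" where
  "relator_ideal = Idl\<^bsub>F2uv\<^esub> relators"

lemma F2uv_simps [simp]:
  "carrier F2uv = UNIV" "x \<otimes>\<^bsub>F2uv\<^esub> y = x * y" "\<one>\<^bsub>F2uv\<^esub> = 1" "\<zero>\<^bsub>F2uv\<^esub> = 0"
  "x \<oplus>\<^bsub>F2uv\<^esub> y = x + y"
  by (simp_all add: ring_of_type_algebra_def)

lemma F2uv_uminus [simp]: "\<ominus>\<^bsub>F2uv\<^esub> x = - x"
proof -
  interpret ring F2uv by (rule ring_F2uv)
  show ?thesis
    by (rule minus_equality) simp_all
qed

lemma F2uv_minus [simp]: "x \<ominus>\<^bsub>F2uv\<^esub> y = x - y"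
  by (simp add: a_minus_def)

abbreviation word :: "gen list \<Rightarrow> (bit, gen) free_algebra" where
  "word w \<equiv> Poly_Mapping.single w 1"

lemma word_mult: "word v * word w = word (v @ w)"
  by (simp add: mult_single plus_list_def)

lemma relators_eq:
  "relators = {word [U, U, U], word [V, V], word [U, U] + word [U, V] + word [V, U], word [U, V, U]}"
  by (simp add: relators_def Let_def free_gen_def power2_eq_square power3_eq_cube word_mult)

lemma ideal_relator: "ideal relator_ideal F2uv"
  unfolding relator_ideal_def by (rule ring.genideal_ideal[OF ring_F2uv]) simp

text \<open>The kernel of \<open>coords\<close> is an ideal containing the four relators, hence
  contains the ideal they generate.\<close>

lemma coords_relator: "p \<in> relator_ideal \<Longrightarrow> coords p = 0"
proof -
  have q0: "qmult t 0 = 0" "qmult 0 t = 0" for t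
    by (cases t; simp add: zero_prod_def)+
  have "ideal {p. coords p = 0} F2uv"
  proof (rule idealI[OF ring_F2uv])
    interpret ring F2uv by (rule ring_F2uv)
    show "subgroup {p. coords p = 0} (add_monoid F2uv)"
      by (rule add.subgroupI) (auto intro: exI[of _ 0])
  qed (simp_all add: q0)
  moreover have "relators \<subseteq> {p. coords p = 0}"
    by (simp add: relators_eq coords_def lookup_single lookup_add zero_prod_def)
  ultimately have "relator_ideal \<subseteq> {p. coords p = 0}"
    unfolding relator_ideal_def by (rule ring.genideal_minimal[OF ring_F2uv])
  then show "p \<in> relator_ideal \<Longrightarrow> coords p = 0"
    by blast
qed

lemma relator_ideal_closed:
  shows "0 \<in> relator_ideal"
    and "\<lbrakk>p \<in> relator_ideal; q \<in> relator_ideal\<rbrakk> \<Longrightarrow> p + q \<in> relator_ideal"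
    and "\<lbrakk>p \<in> relator_ideal; q \<in> relator_ideal\<rbrakk> \<Longrightarrow> p - q \<in> relator_ideal"
    and "p \<in> relator_ideal \<Longrightarrow> p * r \<in> relator_ideal"
    and "p \<in> relator_ideal \<Longrightarrow> r * p \<in> relator_ideal"
proof -
  interpret ideal relator_ideal F2uv by (rule ideal_relator)
  show "0 \<in> relator_ideal" 
    using additive_subgroup.zero_closed[OF is_additive_subgroup] by simp
  show add: "p + q \<in> relator_ideal" if "p \<in> relator_ideal" "q \<in> relator_ideal" for p q
    using additive_subgroup.a_closed[OF is_additive_subgroup that] by simp
  show "p - q \<in> relator_ideal" if "p \<in> relator_ideal" "q \<in> relator_ideal"
    using add[OF that(1) additive_subgroup.a_inv_closed[OF is_additive_subgroup that(2)]] by simp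
  show "p * r \<in> relator_ideal" "r * p \<in> relator_ideal" if "p \<in> relator_ideal"
    using I_r_closed[OF that, of r] I_l_closed[OF that, of r] by simp_all
qed

lemma relators_in_relator_ideal:
  "word [U, U, U] \<in> relator_ideal" "word [V, V] \<in> relator_ideal"
  "word [U, U] + word [U, V] + word [V, U] \<in> relator_ideal" "word [U, V, U] \<in> relator_ideal"
proof -
  have "relators \<subseteq> relator_ideal"
    unfolding relator_ideal_def by (rule ring.genideal_self[OF ring_F2uv]) simp
  then show "word [U, U, U] \<in> relator_ideal" "word [V, V] \<in> relator_ideal"
    "word [U, U] + word [U, V] + word [V, U] \<in> relator_ideal" "word [U, V, U] \<in> relator_ideal"
    by (simp_all add: relators_eq)
qed

lemma word_3_in_relator_ideal: "word (x # y # z # w) \<in> relator_ideal"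
proof -
  let ?I = relator_ideal
  note c = relator_ideal_closed
  note UUU = relators_in_relator_ideal(1) and VV = relators_in_relator_ideal(2)
    and Q = relators_in_relator_ideal(3) and UVU = relators_in_relator_ideal(4)
  have VVx: "word [V, V, x] \<in> ?I" and xVV: "word [x, V, V] \<in> ?I" for x
    using c(4)[OF VV, of "word [x]"] c(5)[OF VV, of "word [x]"] by (simp_all add: word_mult)
  \<comment> \<open>Multiply the relator \<open>u^2 + uv + vu\<close> by a generator and subtract
    the two words already known: \<open>u\<close> on the left gives \<open>uuv\<close>,
    \<open>u\<close> on the right gives \<open>vuu\<close>, \<open>v\<close> on the left gives
    \<open>vuv\<close>.\<close>
  have UUV: "word [U, U, V] \<in> ?I"
    using c(3)[OF c(3)[OF c(5)[OF Q, of "word [U]"] UUU] UVU] by (simp add: distrib_left word_mult)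
  have VUU: "word [V, U, U] \<in> ?I"
    using c(3)[OF c(3)[OF c(4)[OF Q, of "word [U]"] UUU] UVU] by (simp add: distrib_right word_mult)
  have VUV: "word [V, U, V] \<in> ?I"
    using c(3)[OF c(3)[OF c(5)[OF Q, of "word [V]"] VUU] VVx[of U]] by (simp add: distrib_left word_mult)
  have "word [x, y, z] \<in> ?I"
    using UUU UVU VVx xVV UUV VUU VUV by (cases x; cases y; cases z) blast+
  from c(4)[OF this, of "word w"] show ?thesis
    by (simp add: word_mult)
qed

text \<open>Every element reduces modulo the relators to its normal form, so elements with zero
  coordinates lie in the ideal. By additivity it suffices to treat single words.\<close>

lemma diff_rep_in_relator_ideal: "p - rep (coords p) \<in> relator_ideal"
proof (induction p rule: update_induct)
  case const
  then show ?case
    by (simp add: relator_ideal_closed)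
next
  case (update f w k)
  have "word w - rep (coords (word w)) \<in> relator_ideal"
  proof (cases "\<exists>x y z w'. w = x # y # z # w'")
    case True
    then have "coords (word w) = 0" "word w \<in> relator_ideal"
      using word_3_in_relator_ideal by (auto simp: coords_def lookup_single zero_prod_def)
    then show ?thesis by simp
  next
    case False
    then consider "w = []" | x where "w = [x]" | x y where "w = [x, y]"
      by (metis list.exhaust)
    then show ?thesis
    proof cases
      case 1
      then show ?thesis by (simp add: coords_def lookup_single relator_ideal_closed)
    next
      case 2
      then show ?thesis by (cases x) (simp_all add: coords_def lookup_single relator_ideal_closed)
    next
      case 3
      \<comment> \<open>In characteristic 2, subtracting the normal form \<open>uv + vu\<close> of
        \<open>u^2\<close> gives precisely the third relator.\<close>
      have "- word v = word v" for v :: "gen list"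
        by (simp flip: single_uminus)
      then have "word [U, U] - rep (coords (word [U, U])) = word [U, U] + word [U, V] + word [V, U]"
        by (simp add: coords_def lookup_single diff_conv_add_uminus ac_simps del: add_uminus_conv_diff)
      then have "word [U, U] - rep (coords (word [U, U])) \<in> relator_ideal"
        by (simp only: relators_in_relator_ideal)
      moreover have "word w - rep (coords (word w)) = 0" if "x \<noteq> y"
        using 3 that by (cases x; cases y) (simp_all add: coords_def lookup_single)
      moreover have "rep (coords (word [V, V])) = 0"
        by (simp add: coords_def lookup_single)
      ultimately have "word [U, U] - rep (coords (word [U, U])) \<in> relator_ideal"
        "word [V, V] - rep (coords (word [V, V])) \<in> relator_ideal"
        "x \<noteq> y \<Longrightarrow> word w - rep (coords (word w)) \<in> relator_ideal"
        using relators_in_relator_ideal(2) relator_ideal_closed(1) by (blast, simp, simp)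
      then show ?thesis
        using 3 by (cases x; cases y) blast+
    qed
  qed
  then have "(f - rep (coords f)) + (word w - rep (coords (word w))) \<in> relator_ideal"
    using update.IH relator_ideal_closed(2) by blast
  moreover have "k = 1"
    using update.hyps by simp
  then have "Poly_Mapping.update w k f = f + word w"
    using update.hyps
    by (intro poly_mapping_eqI) (auto simp: lookup_update lookup_add lookup_single when_def in_keys_iff)
  ultimately show ?case
    by (simp only: coords_add rep_add add_diff_add)
qed

lemma relator_ideal_eq: "relator_ideal = {p. coords p = 0}"
proof
  show "{p. coords p = 0} \<subseteq> relator_ideal"
  proof clarify
    fix p assume "coords p = 0"
    then show "p \<in> relator_ideal"
      using diff_rep_in_relator_ideal[of p] by simp
  qed
qed (use coords_relator in blast)

section \<open>The quotient ring: order 32, symmetric, not duo\<close>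

lemma F2uv_quotient_eq: "F2uv_quotient = F2uv Quot relator_ideal"
  by (simp add: F2uv_quotient_def relator_ideal_def relators_def Let_def)

abbreviation cls :: "(bit, gen) free_algebra \<Rightarrow> (bit, gen) free_algebra set" where
  "cls p \<equiv> relator_ideal +>\<^bsub>F2uv\<^esub> p"

text \<open>Turns equations in the quotient into equations between bit tuples.\<close>

lemma cls_eq_iff: "cls p = cls q \<longleftrightarrow> coords p = coords q"
proof -
  have "cls p = cls q \<longleftrightarrow> p - q \<in> relator_ideal"
    using ring.quotient_eq_iff_same_a_r_cos[OF ring_F2uv ideal_relator, of p q] by simp
  then show ?thesis
    by (simp only: relator_ideal_eq mem_Collect_eq coords_diff right_minus_eq)
qed

lemma carrier_F2uv_quotient: "carrier F2uv_quotient = range cls"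
  unfolding F2uv_quotient_eq by (auto simp: FactRing_def A_RCOSETS_def' a_r_coset_def')

lemma zero_F2uv_quotient: "\<zero>\<^bsub>F2uv_quotient\<^esub> = cls 0"
proof -
  interpret ideal relator_ideal F2uv by (rule ideal_relator)
  show ?thesis
    unfolding F2uv_quotient_eq using a_coset_add_zero[of relator_ideal] by (simp add: FactRing_def)
qed

lemma mult_F2uv_quotient: "cls p \<otimes>\<^bsub>F2uv_quotient\<^esub> cls q = cls (p * q)"
  unfolding F2uv_quotient_eq
  using ideal.rcoset_mult_add[OF ideal_relator, of p q] by (simp add: FactRing_def)

lemma ring_F2uv_quotient: "ring F2uv_quotient"
  unfolding F2uv_quotient_eq by (rule ideal.quotient_is_ring[OF ideal_relator])

lemma card_F2uv_quotient: "card (carrier F2uv_quotient) = 32"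
proof -
  have "bij_betw (\<lambda>t. cls (rep t)) UNIV (carrier F2uv_quotient)"
  proof (rule bij_betw_imageI)
    show "inj (\<lambda>t. cls (rep t))"
      by (rule injI) (simp only: cls_eq_iff coords_rep)
    have "cls p = cls (rep (coords p))" for p
      by (simp only: cls_eq_iff coords_rep)
    then show "range (\<lambda>t. cls (rep t)) = carrier F2uv_quotient"
      unfolding carrier_F2uv_quotient by blast
  qed
  then have "card (carrier F2uv_quotient) = card (UNIV :: quint set)"
    by (metis bij_betw_same_card)
  also have "\<dots> = 32"
  proof -
    have "(UNIV :: bit set) = {0, 1}"
      using bit.exhaust by auto
    then have "card (UNIV :: bit set) = 2"
      by (metis card_2_iff zero_neq_one)
    then show ?thesis
      by (simp flip: UNIV_Times_UNIV add: card_cartesian_product)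
  qed
  finally show ?thesis .
qed

text \<open>The commutator \<open>ab - ba\<close> lies in the square of the radical, so \<open>abc = bac\<close> when \<open>c\<close> is in
  the radical; otherwise \<open>c\<close> is a unit.\<close>

lemma qmult_symmetric:
  assumes "qmult (qmult a b) c = 0"
  shows "qmult (qmult b a) c = 0"
proof -
  obtain a0 a1 a2 a3 a4 where a: "a = (a0, a1, a2, a3, a4)" by (cases a)
  obtain b0 b1 b2 b3 b4 where b: "b = (b0, b1, b2, b3, b4)" by (cases b)
  obtain c0 c1 c2 c3 c4 where c: "c = (c0, c1, c2, c3, c4)" by (cases c)
  show ?thesis
  proof (cases c0)
    case zero
    then have "qmult (qmult b a) c = qmult (qmult a b) c"
      by (simp add: a b c algebra_simps)
    then show ?thesis using assms by simp
  next
    case one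
    \<comment> \<open>With constant coordinate 1, \<open>c\<close> acts on the right by a
      unitriangular system, so the coordinates of \<open>t\<close> vanish one after another.\<close>
    have inj: "t = 0" if t: "qmult t c = 0" for t
    proof -
      obtain t0 t1 t2 t3 t4 where "t = (t0, t1, t2, t3, t4)" by (cases t)
      then show ?thesis
        using t one by (auto simp: c zero_prod_def)
    qed
    have "qmult a b = 0"
      using inj assms by blast
    \<comment> \<open>If \<open>a\<close> or \<open>b\<close> has constant coordinate 1, the other
      one is zero. If neither has, exchanging the factors merely swaps the last two coordinates of
      the product.\<close>
    then have "qmult b a = 0"
      unfolding a b zero_prod_def
      by (cases a0; cases b0; cases a1; cases b1; cases a2; cases b2) (auto simp: add_bit_eq_xor mult_bit_eq_and)
    then show ?thesis
      by (simp add: c zero_prod_def)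
  qed
qed

lemma symmetric_F2uv_quotient: "symmetric_ring F2uv_quotient"
proof -
  interpret ring F2uv_quotient by (rule ring_F2uv_quotient)
  show ?thesis
  proof
    fix A B C
    assume "A \<in> carrier F2uv_quotient" "B \<in> carrier F2uv_quotient" "C \<in> carrier F2uv_quotient"
    then obtain p q r where "A = cls p" "B = cls q" "C = cls r"
      unfolding carrier_F2uv_quotient by blast
    moreover assume "A \<otimes>\<^bsub>F2uv_quotient\<^esub> B \<otimes>\<^bsub>F2uv_quotient\<^esub> C = \<zero>\<^bsub>F2uv_quotient\<^esub>"
    ultimately show "B \<otimes>\<^bsub>F2uv_quotient\<^esub> A \<otimes>\<^bsub>F2uv_quotient\<^esub> C = \<zero>\<^bsub>F2uv_quotient\<^esub>"
      by (simp only: mult_F2uv_quotient zero_F2uv_quotient cls_eq_iff coords_mult coords_zero qmult_symmetric)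
  qed
qed

text \<open>Right duo fails at \<open>uv \<notin> vR\<close>: a product \<open>vr\<close> has
  \<open>uv\<close>-coordinate 0, whereas that of \<open>uv\<close> is 1.\<close>

lemma not_duo_F2uv_quotient: "\<not> duo_ring F2uv_quotient"
proof
  assume "duo_ring F2uv_quotient"
  then interpret right_duo_ring F2uv_quotient
    by (simp add: duo_ring_def)
  have "cls (word [U]) \<otimes>\<^bsub>F2uv_quotient\<^esub> cls (word [V])
      \<in> cls (word [V]) <#\<^bsub>F2uv_quotient\<^esub> carrier F2uv_quotient"
    by (rule right_duo) (auto simp: carrier_F2uv_quotient)
  then obtain r where "cls (word [U]) \<otimes>\<^bsub>F2uv_quotient\<^esub> cls (word [V])
      = cls (word [V]) \<otimes>\<^bsub>F2uv_quotient\<^esub> cls r"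
    unfolding l_coset_def carrier_F2uv_quotient by blast
  then have "qmult (coords (word [U])) (coords (word [V])) = qmult (coords (word [V])) (coords r)"
    by (simp only: mult_F2uv_quotient cls_eq_iff coords_mult)
  then show False
    by (cases "coords r") (simp add: coords_def lookup_single)
qed


theorem theorem3p9:
  shows "(\<forall>R :: ('a, 'm) ring_scheme.
            symmetric_ring R \<and> \<not> duo_ring R \<and> finite (carrier R) \<longrightarrow> 32 \<le> Coset.order R)
    \<and> symmetric_ring F2uv_quotient \<and> \<not> duo_ring F2uv_quotient
    \<and> finite (carrier F2uv_quotient) \<and> Coset.order F2uv_quotient = 32"
  using symmetric_ring.order_ge_32 symmetric_F2uv_quotient not_duo_F2uv_quotient card_F2uv_quotient
  by (auto simp: Coset.order_def intro: card_ge_0_finite)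

end
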